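(* Let $A$ be a non-empty subset of $\mathbb{F}_q$, let $S=\{s_1,\ldots,s_m\}$ (with $|S|=m$) and $\bar S$ be finite sets with $\sharp S=\sharp\bar S$, and let $f:A\to A$, $h:S\to\bar S$, $\lambda:A\to S$, $\bar\lambda:A\to\bar S$ be maps with $\lambda,\bar\lambda$ surjective and $\bar\lambda\circ f=h\circ\lambda$. Suppose $f$ is a bijection. For $i=1,\ldots,m$ put $A_i=\lambda^{-1}(s_i)$, $B_i=f(A_i)$, let $f_i=f|_{A_i}:A_i\to B_i$, and let $f_i^{-1}:B_i\to A_i$ be the inverse of $f_i$, i.e. $f_i^{-1}(f_i(x))=x$ for $x\in A_i$. Then for all $x\in A$, $$f^{-1}(x)=\sum_{i=1}^m\chi_{B_i}(x)\,f_i^{-1}(x),$$ where the $i$-th summand is understood to be $0$ when $x\notin B_i$.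
   Context: $\mathbb{F}_q$ is the finite field with $q$ elements; $\sharp X$ denotes cardinality. For a non-empty subset $T\subseteq A$, $\chi_T$ is the $\mathbb{F}_q$-valued characteristic function: $\chi_T(x)=1$ if $x\in T$ and $\chi_T(x)=0$ otherwise. *)

theory Defs
  imports Main "HOL-Library.FuncSet" "HOL-Library.Indicator_Function"
begin

end

theory Submission imports Defs begin

text \<open>The fibres \<open>As i\<close> of \<open>lam\<close> partition \<open>A\<close>, and the
  bijection \<open>f\<close> carries this partition to the partition of \<open>A\<close> into the
  sets \<open>Bs i\<close>. Hence a point x of \<open>A\<close> lies in exactly one
  \<open>Bs k\<close>, where \<open>s k\<close> is the \<open>lam\<close>-value of its preimage y
  under \<open>f\<close>. On \<open>As k\<close> the map \<open>fs k\<close> agrees with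
  \<open>f\<close>, so its inverse sends x to the same y, and the sum collapses to that single
  term.\<close>

theorem theorem4p1:
  fixes A :: "'a::{finite,field} set"
    and S :: "'b set" and Sbar :: "'c set"
    and s :: "nat \<Rightarrow> 'b" and m :: nat
    and f :: "'a \<Rightarrow> 'a" and h :: "'b \<Rightarrow> 'c"
    and lam :: "'a \<Rightarrow> 'b" and lambar :: "'a \<Rightarrow> 'c"
    and As Bs :: "nat \<Rightarrow> 'a set"
    and fs fs_inv :: "nat \<Rightarrow> 'a \<Rightarrow> 'a"
  assumes "A \<noteq> {}"
    and "finite S" and "finite Sbar" and "card S = card Sbar"
    and "bij_betw s {1..m} S"
    and "f \<in> A \<rightarrow> A" and "h \<in> S \<rightarrow> Sbar"
    and "lam \<in> A \<rightarrow> S" and "lambar \<in> A \<rightarrow> Sbar"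
    and "lam ` A = S" and "lambar ` A = Sbar"
    and "\<And>x. x \<in> A \<Longrightarrow> lambar (f x) = h (lam x)"
    and "bij_betw f A A"
    and "\<And>i. i \<in> {1..m} \<Longrightarrow> As i = {x \<in> A. lam x = s i}"
    and "\<And>i. i \<in> {1..m} \<Longrightarrow> Bs i = f ` As i"
    and "\<And>i. i \<in> {1..m} \<Longrightarrow> fs i = restrict f (As i)"
    and "\<And>i. i \<in> {1..m} \<Longrightarrow> fs_inv i = inv_into (As i) (fs i)"
  shows "\<forall>x\<in>A. inv_into A f x = (\<Sum>i=1..m. indicator (Bs i) x * fs_inv i x)"
proof
  fix x assume x: "x \<in> A"
  define y where "y = inv_into A f x"
  have inj: "inj_on f A" and onto: "f ` A = A"
    using \<open>bij_betw f A A\<close> by (auto simp: bij_betw_def)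
  have y: "y \<in> A" "f y = x"
    using x onto unfolding y_def by (auto intro: inv_into_into f_inv_into_f)
  have "lam y \<in> s ` {1..m}"
    using y(1) \<open>lam \<in> A \<rightarrow> S\<close> \<open>bij_betw s {1..m} S\<close> by (auto simp: bij_betw_def)
  then obtain k where k: "k \<in> {1..m}" "lam y = s k"
    by blast
  have inj_s: "inj_on s {1..m}"
    using \<open>bij_betw s {1..m} S\<close> by (simp add: bij_betw_def)
  have Bs_iff: "x \<in> Bs i \<longleftrightarrow> i = k" if i: "i \<in> {1..m}" for i
  proof -
    \<comment> \<open>Any preimage of \<open>x\<close> in \<open>As i\<close> lies in
      \<open>A\<close>, so injectivity of \<open>f\<close> on all of \<open>A\<close> identifies it
      with \<open>y\<close>.\<close>
    have "x \<in> Bs i \<longleftrightarrow> y \<in> As i"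
      using y inj assms(14,15)[OF i] by (auto dest: inj_onD)
    also have "\<dots> \<longleftrightarrow> s i = s k"
      using y(1) k(2) assms(14)[OF i] by auto
    also have "\<dots> \<longleftrightarrow> i = k"
      using inj_s i k(1) by (auto dest: inj_onD)
    finally show ?thesis .
  qed
  have yk: "y \<in> As k"
    using y(1) k assms(14) by auto
  have "inj_on (fs k) (As k)"
    using inj assms(14,16)[OF k(1)] by (auto simp: inj_on_def)
  moreover have "fs k y = x"
    using yk y(2) assms(16)[OF k(1)] by simp
  ultimately have inv_k: "fs_inv k x = y"
    using yk assms(17)[OF k(1)] by (auto intro: inv_into_f_eq)
  \<comment> \<open>For i other than \<open>k\<close>, \<open>x\<close> is outside the image of
    \<open>fs i\<close>, so \<open>fs_inv i x\<close> is an unspecified field element; the zero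
    indicator annihilates it, which realizes the convention that such a summand is 0.\<close>
  have "(\<Sum>i=1..m. indicator (Bs i) x * fs_inv i x) = (\<Sum>i=1..m. if i = k then y else 0)"
    using inv_k by (intro sum.cong refl) (auto simp: indicator_def Bs_iff)
  also have "\<dots> = y"
    using k(1) by simp
  finally show "inv_into A f x = (\<Sum>i=1..m. indicator (Bs i) x * fs_inv i x)"
    by (simp add: y_def)
qed

end
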